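(* Let $\mathbb{F}_q$ be the finite field with $q$ elements, let $\mathcal{H}=\mathcal{H}(m,n,\mathcal{X},f)$ be the side information hypergraph of an instance $(m,n,\mathcal{X},f)$ of the index coding with side information (ICSI) problem, and let $\delta\ge 0$ be an integer. The length $\mathcal{N}_q(\mathcal{H},\delta)$ of an optimal linear $\delta$-error-correcting index code ($(\delta,\mathcal{H})$-ECIC) over $\mathbb{F}_q$ satisfies $$\mathcal{N}_q(\mathcal{H},\delta)\ \le\ N_q[\kappa_q(\mathcal{H}),2\delta+1],$$ where $\kappa_q(\mathcal{H})$ is the min-rank of $\mathcal{H}$ over $\mathbb{F}_q$.
   Context: Notation: $[n]=\{1,\dots,n\}$; $\mathsf{wt}$ denotes Hamming weight; for $\boldsymbol{x}\in\mathbb{F}_q^n$ and $B\subseteq[n]$, $\boldsymbol{x}_B$ is the subvector of $\boldsymbol{x}$ indexed by $B$; $\boldsymbol{e}_j\in\mathbb{F}_q^n$ is the $j$th unit vector. Vectors are row vectors. ICSI instance: integers $m,n\ge 1$, subsets $\mathcal{X}_i\subseteq[n]$ for $i\in[m]$ with $\mathcal{X}=(\mathcal{X}_1,\dots,\mathcal{X}_m)$, and a map $f:[m]\to[n]$ with $f(i)\notin\mathcal{X}_i$ for all $i$. (Receiver $R_i$ knows $\boldsymbol{x}_{\mathcal{X}_i}$ and wants $x_{f(i)}$.) The side information hypergraph $\mathcal{H}(m,n,\mathcal{X},f)$ is the directed hypergraph with vertex set $[n]$ and edges $(f(i),\mathcal{X}_i)$, $i\in[m]$; it represents the instance. ECIC: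 a $\delta$-error-correcting index code ($(\delta,\mathcal{H})$-ECIC) over $\mathbb{F}_q$ of length $N$ is a map $\mathfrak{E}:\mathbb{F}_q^n\to\mathbb{F}_q^N$ such that for each $i\in[m]$ there is a map $\mathfrak{D}_i:\mathbb{F}_q^N\times\mathbb{F}_q^{|\mathcal{X}_i|}\to\mathbb{F}_q$ with $\mathfrak{D}_i(\mathfrak{E}(\boldsymbol{x})+\boldsymbol{\epsilon}_i,\boldsymbol{x}_{\mathcal{X}_i})=x_{f(i)}$ for all $\boldsymbol{x}\in\mathbb{F}_q^n$ and all $\boldsymbol{\epsilon}_i\in\mathbb{F}_q^N$ with $\mathsf{wt}(\boldsymbol{\epsilon}_i)\le\delta$. It is linear if $\mathfrak{E}(\boldsymbol{x})=\boldsymbol{x}\boldsymbol{L}$ for some $n\times N$ matrix $\boldsymbol{L}$ over $\mathbb{F}_q$. $\mathcal{N}_q(\mathcal{H},\delta)$ is the smallest length of a linear $(\delta,\mathcal{H})$-ECIC over $\mathbb{F}_q$; a linear code attaining it is called optimal. $N_q[k,d]$ is the length of the shortest linear code over $\mathbb{F}_q$ of dimension $k$ and minimum distance $d$. Min-rank: $\kappa_q(\mathcal{H})=\min\{\mathrm{rank}_{\mathbb{F}_q}(\{\boldsymbol{v}_i+\boldsymbol{e}_{f(i)}\}_{i\in[m]}) : \boldsymbol{v}_i\in\mathbb{F}_q^n,\ \mathrm{supp}(\boldsymbol{v}_i)\subseteq\mathcal{X}_i\text{ for all } i\in[m]\}$, where the rank of a family of vectors is the dimension of its span and $\mathrm{supp}(\boldsymbol{v})$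 is the set of positions of nonzero entries. *)

theory Defs
  imports "Jordan_Normal_Form.DL_Rank"
begin

text \<open>Coordinates of vectors in \<open>F\<^sup>n\<close>, vertices of hypergraphs and receivers are numbered
  from 0, so \<open>[n]\<close> is \<open>{..<n}\<close>. The finite field with \<open>q\<close> elements is a type
  of classes \<open>field\<close> and \<open>finite\<close>.\<close>

definition supp :: "'a::zero vec \<Rightarrow> nat set" where
  "supp v = {i. i < dim_vec v \<and> v $ i \<noteq> 0}"

definition wt :: "'a::zero vec \<Rightarrow> nat" where
  "wt v = card (supp v)"

definition subvec :: "'a vec \<Rightarrow> nat set \<Rightarrow> 'a vec" where
  "subvec x B = vec_of_list (nths (list_of_vec x) B)"


section \<open>Linear codes\<close>

definition min_dist :: "'a::field vec set \<Rightarrow> nat" where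
  "min_dist C = (LEAST d. \<exists>x\<in>C. \<exists>y\<in>C. x \<noteq> y \<and> d = wt (x - y))"

definition (in vec_space) linear_code :: "'a vec set \<Rightarrow> nat \<Rightarrow> nat \<Rightarrow> bool" where
  "linear_code C k d \<longleftrightarrow>
     subspace class_ring C V \<and> vectorspace.dim class_ring (vs C) = k \<and> min_dist C = d"

text \<open>\<open>N\<^sub>q[k,d]\<close>. The set of admissible lengths is nonempty whenever \<open>k\<close> and \<open>d\<close> are positive
  (repeat each of \<open>k\<close> symbols \<open>d\<close> times).\<close>

definition shortest_code_length :: "'a::field itself \<Rightarrow> nat \<Rightarrow> nat \<Rightarrow> nat" where
  "shortest_code_length _ k d = (LEAST N. \<exists>C :: 'a vec set. vec_space.linear_code N C k d)"


section \<open>Index coding with side information\<close>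

definition icsi_instance :: "nat \<Rightarrow> nat \<Rightarrow> (nat \<Rightarrow> nat set) \<Rightarrow> (nat \<Rightarrow> nat) \<Rightarrow> bool" where
  "icsi_instance m n X f \<longleftrightarrow> 1 \<le> m \<and> 1 \<le> n \<and>
     (\<forall>i<m. X i \<subseteq> {..<n} \<and> f i < n \<and> f i \<notin> X i)"

text \<open>A directed hypergraph on the vertices \<open>{..<num_vertices H}\<close>. The edges form a family (one
  edge for each receiver, possibly with repetitions), each consisting of a tail vertex and a set of
  head vertices.\<close>

record dihypergraph =
  num_vertices :: nat
  edges :: "(nat \<times> nat set) list"

definition side_info_hypergraph ::
    "nat \<Rightarrow> nat \<Rightarrow> (nat \<Rightarrow> nat set) \<Rightarrow> (nat \<Rightarrow> nat) \<Rightarrow> dihypergraph" where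
  "side_info_hypergraph m n X f =
     \<lparr>num_vertices = n, edges = map (\<lambda>i. (f i, X i)) [0..<m]\<rparr>"

abbreviation num_receivers :: "dihypergraph \<Rightarrow> nat" where
  "num_receivers H \<equiv> length (edges H)"

abbreviation demand :: "dihypergraph \<Rightarrow> nat \<Rightarrow> nat" where
  "demand H i \<equiv> fst (edges H ! i)"

abbreviation side_info :: "dihypergraph \<Rightarrow> nat \<Rightarrow> nat set" where
  "side_info H i \<equiv> snd (edges H ! i)"

definition ecic :: "nat \<Rightarrow> dihypergraph \<Rightarrow> nat \<Rightarrow> ('a::field vec \<Rightarrow> 'a vec) \<Rightarrow> bool" where
  "ecic \<delta> H N E \<longleftrightarrow>
     (\<forall>x \<in> carrier_vec (num_vertices H). E x \<in> carrier_vec N) \<and>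
     (\<forall>i < num_receivers H. \<exists>D :: 'a vec \<Rightarrow> 'a vec \<Rightarrow> 'a.
        \<forall>x \<in> carrier_vec (num_vertices H). \<forall>\<epsilon> \<in> carrier_vec N. wt \<epsilon> \<le> \<delta> \<longrightarrow>
          D (E x + \<epsilon>) (subvec x (side_info H i)) = x $ demand H i)"

text \<open>The row vector \<open>x L\<close> is the column vector \<open>L\<^sup>T x\<close>.\<close>

definition linear_encoder :: "nat \<Rightarrow> nat \<Rightarrow> ('a::field vec \<Rightarrow> 'a vec) \<Rightarrow> bool" where
  "linear_encoder n N E \<longleftrightarrow>
     (\<exists>L \<in> carrier_mat n N. \<forall>x \<in> carrier_vec n. E x = transpose_mat L *\<^sub>v x)"

definition opt_ecic_length :: "'a::field itself \<Rightarrow> dihypergraph \<Rightarrow> nat \<Rightarrow> nat" where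
  "opt_ecic_length _ H \<delta> =
     (LEAST N. \<exists>E :: 'a vec \<Rightarrow> 'a vec. ecic \<delta> H N E \<and> linear_encoder (num_vertices H) N E)"

definition (in vec_space) family_rank :: "nat set \<Rightarrow> (nat \<Rightarrow> 'a vec) \<Rightarrow> nat" where
  "family_rank I w = vectorspace.dim class_ring (span_vs (w ` I))"

definition min_rank :: "'a::field itself \<Rightarrow> dihypergraph \<Rightarrow> nat" where
  "min_rank _ H =
     (LEAST r. \<exists>v :: nat \<Rightarrow> 'a vec.
        (\<forall>i < num_receivers H. v i \<in> carrier_vec (num_vertices H) \<and> supp (v i) \<subseteq> side_info H i) \<and>
        r = vec_space.family_rank (num_vertices H) {..<num_receivers H}
              (\<lambda>i. v i + unit_vec (num_vertices H) (demand H i)))"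

end

(* Let W be the span of a family of vectors v_i + e_{f(i)} attaining the min-rank k, let C be a
   shortest [k, 2 delta + 1] code, and let the columns of B and of G be bases of W and C. The encoder
   x |-> G (B^T x) takes values in C, so up to delta errors are corrected and B^T x is recovered. This
   gives all inner products of x with elements of W, in particular <x, v_i> + x_{f(i)}, where the
   receiver computes <x, v_i> from its side information. That a [k, 2 delta + 1] code exists at all
   is shown by a repetition code; this needs k > 0, which holds because v_i vanishes at f(i). *)

theory Submission
  imports Defs
begin

section \<open>Subvectors, supports and Hamming weight\<close>

lemma nths_eqD:
  assumes "nths xs A = nths ys A" "length xs = length ys" "i < length xs" "i \<in> A"
  shows "xs ! i = ys ! i"
  using assms(2,1,3,4)
proof (induction xs ys arbitrary: A i rule: list_induct2)
  case Nil
  then show ?case by simp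
next
  case (Cons x xs y ys)
  \<comment> \<open>Both selections keep the head or both drop it, so the remaining entries agree,
    with the index set shifted down by one.\<close>
  have tl: "nths xs {j. Suc j \<in> A} = nths ys {j. Suc j \<in> A}"
    using Cons.prems(1) by (simp add: nths_Cons split: if_splits)
  show ?case
  proof (cases i)
    case 0
    then show ?thesis using Cons.prems by (simp add: nths_Cons)
  next
    case (Suc j)
    then show ?thesis using Cons.IH[OF tl, of j] Cons.prems by simp
  qed
qed

lemma subvec_eqD:
  assumes "subvec x A = subvec y A" "x \<in> carrier_vec n" "y \<in> carrier_vec n" "i < n" "i \<in> A"
  shows "x $ i = y $ i"
proof -
  have "nths (list_of_vec x) A = nths (list_of_vec y) A"
    using arg_cong[OF assms(1), of list_of_vec] by (simp add: subvec_def list_vec)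
  from nths_eqD[OF this, of i] assms(2-) show ?thesis
    by (simp add: list_of_vec_index)
qed

text \<open>Terms outside the support of \<open>v\<close> vanish. With support contained in the side
  information, this lets a receiver evaluate its inner product with \<open>v\<close>.\<close>

lemma scalar_prod_eq_on_supp:
  assumes "v \<in> carrier_vec n" "x \<in> carrier_vec n" "y \<in> carrier_vec n"
    and "\<And>i. i \<in> supp v \<Longrightarrow> x $ i = y $ i"
  shows "x \<bullet> v = y \<bullet> v"
  using assms unfolding scalar_prod_def supp_def
  by (intro sum.cong) (auto, metis mult_zero_right)

lemma wt_minus_le:
  fixes x y :: "'a::field vec"
  assumes "x \<in> carrier_vec n" "y \<in> carrier_vec n"
  shows "wt (x - y) \<le> wt x + wt y"
proof -
  have "supp (x - y) \<subseteq> supp x \<union> supp y"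
    using assms by (auto simp: supp_def)
  moreover have "finite (supp x \<union> supp y)" by (simp add: supp_def)
  ultimately show ?thesis
    unfolding wt_def by (meson card_Un_le card_mono le_trans)
qed

lemma min_dist_le:
  assumes "x \<in> C" "y \<in> C" "x \<noteq> y"
  shows "min_dist C \<le> wt (x - y)"
  unfolding min_dist_def using assms by (intro Least_le) blast

lemma mult_mat_unit_vec:
  fixes A :: "'a::semiring_1 mat"
  assumes "A \<in> carrier_mat n k" "i < k"
  shows "A *\<^sub>v unit_vec k i = col A i"
  using assms by (intro eq_vecI) (auto simp: scalar_prod_right_unit[of _ k])

lemma inj_on_mult_mat_vecI:
  fixes A :: "'a::field mat"
  assumes A: "A \<in> carrier_mat n k"
    and ker: "\<And>y. y \<in> carrier_vec k \<Longrightarrow> A *\<^sub>v y = 0\<^sub>v n \<Longrightarrow> y = 0\<^sub>v k"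
  shows "inj_on ((*\<^sub>v) A) (carrier_vec k)"
proof (rule inj_onI)
  fix x y assume xy: "x \<in> carrier_vec k" "y \<in> carrier_vec k" "A *\<^sub>v x = A *\<^sub>v y"
  then have "A *\<^sub>v (x - y) = 0\<^sub>v n"
    using A by (simp add: mult_minus_distrib_mat_vec)
  then have 0: "x - y = 0\<^sub>v k" using ker xy by simp
  show "x = y"
  proof (rule eq_vecI)
    show "x $ i = y $ i" if "i < dim_vec y" for i
      using arg_cong[OF 0, of "\<lambda>v. v $ i"] xy that by simp
  qed (use xy in simp)
qed

section \<open>Subspaces as ranges of injective matrices\<close>

context vec_space
begin

lemma span_cols_eq_range:
  assumes A: "A \<in> carrier_mat n k"
  shows "span (set (cols A)) = (*\<^sub>v) A ` carrier_vec k"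
proof -
  have "A *\<^sub>v x \<in> carrier_vec n" if "x \<in> carrier_vec k" for x using A that by simp
  moreover have "dim_row A = n" "dim_col A = k" using A by auto
  ultimately show ?thesis
    using col_space_eq[OF A] unfolding col_space_def by auto
qed

text \<open>The columns of \<open>A\<close> are a maximal independent subset of \<open>C\<close>:
  spanning gives the range, independence gives a trivial kernel. The matrix form turns dimension
  statements into coordinates of length \<open>k\<close>.\<close>

lemma subspace_basis_mat:
  assumes C: "subspace class_ring C V" and k: "vectorspace.dim class_ring (vs C) = k"
  obtains A where "A \<in> carrier_mat n k" "C = (*\<^sub>v) A ` carrier_vec k"
    "inj_on ((*\<^sub>v) A) (carrier_vec k)"
proof -
  interpret C: vectorspace class_ring "vs C" by (rule subspace_is_vs[OF C])
  have sub: "submodule class_ring C V" using C by simp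
  have CV: "C \<subseteq> carrier_vec n" using submodule.subset[OF sub] by simp
  \<comment> \<open>Independence means the same in \<open>vs C\<close> as in the ambient space, so
    maximality can be carried over to \<open>vs C\<close> below.\<close>
  note li = span_li_not_depend(2)[OF _ sub]
  have "\<exists>S. finite S \<and> maximal S (\<lambda>S. S \<subseteq> C \<and> lin_indpt S)"
  proof (rule maximal_exists)
    \<comment> \<open>The ambient dimension \<open>n\<close> bounds every independent set, so a
      maximal one exists.\<close>
    show "finite S \<and> card S \<le> n" if "S \<subseteq> C \<and> lin_indpt S" for S
      using li_le_dim[OF fin_dim, of S] that CV dim_is_n by auto
    show "{} \<subseteq> C \<and> lin_indpt {}" by (auto simp: lin_dep_def)
  qed
  then obtain S where S: "finite S" "maximal S (\<lambda>S. S \<subseteq> C \<and> lin_indpt S)" by blast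
  then have SC: "S \<subseteq> C" "lin_indpt S" by (auto simp: maximal_def)
  have "maximal S (\<lambda>S. S \<subseteq> carrier (vs C) \<and> C.lin_indpt S)"
    using S(2) li unfolding maximal_def by auto
  then have b: "C.basis S" by (rule C.max_li_is_basis)
  then have card: "card S = k" using C.dim_basis S(1) k by simp
  have span: "span S = C"
    using b span_li_not_depend(1)[OF SC(1) sub] by (simp add: C.basis_def)
  obtain ss where ss: "set ss = S" "distinct ss" using finite_distinct_list[OF S(1)] by blast
  define A where "A = mat_of_cols n ss"
  have len: "length ss = k" using ss card distinct_card by fastforce
  have A: "A \<in> carrier_mat n k" using len unfolding A_def by auto
  have cols: "cols A = ss" unfolding A_def using ss CV SC by (intro cols_mat_of_cols) auto
  have "C = (*\<^sub>v) A ` carrier_vec k"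
    using span_cols_eq_range[OF A] span ss(1) cols by simp
  moreover have "inj_on ((*\<^sub>v) A) (carrier_vec k)"
    using lin_depI[OF A] SC(2) ss cols by (intro inj_on_mult_mat_vecI[OF A]) auto
  ultimately show ?thesis using that A by blast
qed

text \<open>A converse to \<open>subspace_basis_mat\<close>: injectivity makes the columns
  independent, so the range has dimension equal to the number of columns.\<close>

lemma linear_code_range_mat:
  assumes A: "A \<in> carrier_mat n k" and inj: "inj_on ((*\<^sub>v) A) (carrier_vec k)"
    and d: "min_dist ((*\<^sub>v) A ` carrier_vec k) = d"
  shows "linear_code ((*\<^sub>v) A ` carrier_vec k) k d"
proof -
  have cV: "set (cols A) \<subseteq> carrier_vec n" using A cols_dim by blast
  have C: "(*\<^sub>v) A ` carrier_vec k = span (set (cols A))"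
    by (rule span_cols_eq_range[OF A, symmetric])
  have A0: "A *\<^sub>v 0\<^sub>v k = 0\<^sub>v n" using A by auto
  \<comment> \<open>Independence speaks of the set of columns and would not notice a repeated one.
    Equal columns would be equal images of two unit vectors.\<close>
  have dist: "distinct (cols A)"
  proof (unfold distinct_conv_nth, intro allI impI notI)
    fix i j assume ij: "i < length (cols A)" "j < length (cols A)" "i \<noteq> j" "cols A ! i = cols A ! j"
    then have "A *\<^sub>v unit_vec k i = A *\<^sub>v unit_vec k j"
      using A by (simp add: mult_mat_unit_vec[OF A])
    then have "unit_vec k i = (unit_vec k j :: 'a vec)"
      using inj by (auto dest: inj_onD)
    then show False using ij A by (simp add: unit_vec_eq)
  qed
  have "lin_indpt (set (cols A))"
  proof
    assume "lin_dep (set (cols A))"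
    from lin_depE[OF A this dist] obtain v
      where "v \<in> carrier_vec k" "v \<noteq> 0\<^sub>v k" "A *\<^sub>v v = 0\<^sub>v n" by blast
    then show False using inj_onD[OF inj, of v "0\<^sub>v k"] A0 by auto
  qed
  from lin_indpt_full_rank[OF A dist this] show ?thesis
    using d span_is_subspace[of "set (cols A)"] cV
    unfolding linear_code_def C rank_def by simp
qed

end

section \<open>The repetition code and the existence of codes\<close>

text \<open>These are \<open>d\<close> copies of the identity matrix of size \<open>k\<close>,
  stacked on top of each other; the range consists of \<open>d\<close>-fold repetitions of vectors
  of length \<open>k\<close>.\<close>

definition repetition_mat :: "nat \<Rightarrow> nat \<Rightarrow> 'a::field mat" where
  "repetition_mat k d = mat (k * d) k (\<lambda>(i, j). if i mod k = j then 1 else 0)"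

lemma repetition_mat_carrier: "repetition_mat k d \<in> carrier_mat (k * d) k"
  by (simp add: repetition_mat_def)

lemma repetition_mat_mult:
  assumes "i < k * d" "y \<in> carrier_vec k"
  shows "(repetition_mat k d *\<^sub>v y) $ i = y $ (i mod k)"
proof -
  have "i mod k < k" using assms(1) by (metis mod_less_divisor mult_0 not_gr_zero not_less0)
  moreover have "row (repetition_mat k d :: 'a mat) i = unit_vec k (i mod k)"
    using assms(1) by (intro eq_vecI) (auto simp: repetition_mat_def unit_vec_def)
  ultimately show ?thesis
    using assms repetition_mat_carrier[of k d, where 'a='a] by simp
qed

text \<open>Position \<open>j + k * t\<close> holds symbol \<open>j\<close> in copy
  \<open>t\<close>; conversely, \<open>j\<close> and \<open>t\<close> are the remainder and the
  quotient of the position modulo \<open>k\<close>.\<close>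

lemma repetition_mat_supp:
  assumes "y \<in> carrier_vec k"
  shows "supp (repetition_mat k d *\<^sub>v y) = (\<lambda>(j, t). j + k * t) ` (supp y \<times> {..<d})"
proof (intro equalityI subsetI)
  fix i assume i: "i \<in> supp (repetition_mat k d *\<^sub>v y)"
  then have ikd: "i < k * d"
    using repetition_mat_carrier[of k d, where 'a='a] by (simp add: supp_def)
  then have k: "0 < k" by (cases k) auto
  have "i mod k \<in> supp y" using i ikd k assms by (simp add: supp_def repetition_mat_mult)
  moreover have "i div k < d" using ikd k by (simp add: less_mult_imp_div_less mult.commute)
  moreover have "i = i mod k + k * (i div k)" by simp
  ultimately show "i \<in> (\<lambda>(j, t). j + k * t) ` (supp y \<times> {..<d})"
    by (intro image_eqI[of _ _ "(i mod k, i div k)"]) auto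
next
  fix i assume "i \<in> (\<lambda>(j, t). j + k * t) ` (supp y \<times> {..<d})"
  then obtain j t where jt: "i = j + k * t" "j < k" "y $ j \<noteq> 0" "t < d"
    using assms by (auto simp: supp_def)
  \<comment> \<open>Copy \<open>t\<close> ends before position \<open>k * Suc t\<close>, hence
    within the length \<open>k * d\<close>.\<close>
  have "k * Suc t \<le> k * d" using jt by (intro mult_le_mono2) simp
  then have "i < k * d" using jt by simp
  moreover have "i mod k = j" using jt by simp
  ultimately show "i \<in> supp (repetition_mat k d *\<^sub>v y)"
    using jt(3) repetition_mat_mult[of i k d y] repetition_mat_carrier[of k d, where 'a='a] assms
    by (simp add: supp_def del: index_mult_mat_vec)
qed

text \<open>Remainder and quotient modulo \<open>k\<close> make the description of the support
  injective, so each nonzero symbol counts exactly \<open>d\<close> times.\<close>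

lemma repetition_mat_wt:
  assumes "y \<in> carrier_vec k"
  shows "wt (repetition_mat k d *\<^sub>v y) = wt y * d"
proof -
  have "inj_on (\<lambda>(j, t). j + k * t) (supp y \<times> {..<d})"
  proof (rule inj_onI, clarify)
    fix j t j' t' assume a: "j \<in> supp y" "j' \<in> supp y" "j + k * t = j' + k * t'"
    then have "j < k" "j' < k" using assms by (auto simp: supp_def)
    then show "j = j' \<and> t = t'"
      using arg_cong[OF a(3), of "\<lambda>i. i mod k"] arg_cong[OF a(3), of "\<lambda>i. i div k"] by simp
  qed
  then show ?thesis
    unfolding wt_def repetition_mat_supp[OF assms] by (simp add: card_image card_cartesian_product)
qed

lemma wt_eq_0_iff: "wt x = 0 \<longleftrightarrow> x = 0\<^sub>v (dim_vec x)"
  by (auto simp: wt_def supp_def vec_eq_iff)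

lemma linear_code_exists:
  assumes "0 < k" "0 < d"
  shows "\<exists>N. \<exists>C :: 'a::field vec set. vec_space.linear_code N C k d"
proof -
  let ?A = "repetition_mat k d :: 'a mat"
  let ?C = "(*\<^sub>v) ?A ` carrier_vec k"
  note A = repetition_mat_carrier[of k d, where 'a='a]
  have wt: "d \<le> wt (?A *\<^sub>v y)" if "y \<in> carrier_vec k" "y \<noteq> 0\<^sub>v k" for y
    using that wt_eq_0_iff[of y] by (auto simp: repetition_mat_wt)
  have inj: "inj_on ((*\<^sub>v) ?A) (carrier_vec k)"
  proof (rule inj_on_mult_mat_vecI[OF A])
    fix y :: "'a vec" assume "y \<in> carrier_vec k" "?A *\<^sub>v y = 0\<^sub>v (k * d)"
    then show "y = 0\<^sub>v k" using wt[of y] \<open>0 < d\<close> wt_eq_0_iff[of "0\<^sub>v (k * d) :: 'a vec"] by auto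
  qed
  have "min_dist ?C = d"
    unfolding min_dist_def
  proof (rule Least_equality)
    \<comment> \<open>The distance \<open>d\<close> is attained between zero and the image of a
      vector of weight 1, which exists because \<open>k\<close> is positive.\<close>
    let ?e = "unit_vec k 0 :: 'a vec"
    have "supp ?e = {0}" using \<open>0 < k\<close> by (auto simp: supp_def unit_vec_def split: if_splits)
    then have "wt ?e = 1" by (simp add: wt_def)
    then have w: "wt (?A *\<^sub>v ?e) = d" by (simp add: repetition_mat_wt)
    have z: "?A *\<^sub>v 0\<^sub>v k = 0\<^sub>v (k * d)" using A by auto
    have "0\<^sub>v (k * d) \<in> ?C" using z by (intro image_eqI[of _ _ "0\<^sub>v k"]) auto
    moreover have "?A *\<^sub>v ?e \<in> ?C" by simp
    moreover have "?A *\<^sub>v ?e \<noteq> 0\<^sub>v (k * d)"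
      using w \<open>0 < d\<close> wt_eq_0_iff[of "0\<^sub>v (k * d) :: 'a vec"] by auto
    moreover have "?A *\<^sub>v ?e - 0\<^sub>v (k * d) = ?A *\<^sub>v ?e" 
      using A by (intro eq_vecI) auto
    ultimately show "\<exists>x\<in>?C. \<exists>y\<in>?C. x \<noteq> y \<and> d = wt (x - y)" using w by metis
  next
    fix d' assume "\<exists>x\<in>?C. \<exists>y\<in>?C. x \<noteq> y \<and> d' = wt (x - y)"
    then obtain x y where xy: "x \<in> carrier_vec k" "y \<in> carrier_vec k" "?A *\<^sub>v x \<noteq> ?A *\<^sub>v y"
      "d' = wt (?A *\<^sub>v x - ?A *\<^sub>v y)" by blast
    \<comment> \<open>By linearity the difference of distinct codewords is the image of a nonzero
      vector, so its weight is at least \<open>d\<close>.\<close>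
    have eq: "?A *\<^sub>v x - ?A *\<^sub>v y = ?A *\<^sub>v (x - y)"
      using A xy by (simp add: mult_minus_distrib_mat_vec)
    have "x - y \<noteq> 0\<^sub>v k"
    proof
      assume 0: "x - y = 0\<^sub>v k"
      have "x $ i = y $ i" if "i < k" for i
        using arg_cong[OF 0, of "\<lambda>v. v $ i"] xy that by simp
      then have "x = y" using xy by (intro eq_vecI) auto
      then show False using xy by simp
    qed
    then show "d \<le> d'" using wt[of "x - y"] xy eq by simp
  qed
  from vec_space.linear_code_range_mat[OF A inj this] show ?thesis by blast
qed

section \<open>Attained minima and unique decoding\<close>

lemma shortest_code:
  assumes "0 < k" "0 < d"
  obtains C :: "'a::field vec set"
  where "vec_space.linear_code (shortest_code_length TYPE('a) k d) C k d"
  using LeastI_ex[OF linear_code_exists[OF assms, where 'a='a]]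
  unfolding shortest_code_length_def by blast

text \<open>Zero vectors are an admissible choice of \<open>v\<close>, so the set of ranks is
  nonempty and its least element is attained.\<close>

lemma min_rank_attained:
  obtains v :: "nat \<Rightarrow> 'a::field vec"
  where "\<And>i. i < num_receivers H \<Longrightarrow> v i \<in> carrier_vec (num_vertices H)"
    "\<And>i. i < num_receivers H \<Longrightarrow> supp (v i) \<subseteq> side_info H i"
    "min_rank TYPE('a) H = vec_space.family_rank (num_vertices H) {..<num_receivers H}
       (\<lambda>i. v i + unit_vec (num_vertices H) (demand H i))"
proof -
  let ?P = "\<lambda>r. \<exists>v :: nat \<Rightarrow> 'a vec.
     (\<forall>i < num_receivers H. v i \<in> carrier_vec (num_vertices H) \<and> supp (v i) \<subseteq> side_info H i) \<and>
     r = vec_space.family_rank (num_vertices H) {..<num_receivers H}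
        (\<lambda>i. v i + unit_vec (num_vertices H) (demand H i))"
  have "\<exists>r. ?P r"
    by (intro exI[of _ "\<lambda>_. 0\<^sub>v (num_vertices H)"] exI conjI refl) (auto simp: supp_def)
  then have "?P (min_rank TYPE('a) H)" unfolding min_rank_def by (rule LeastI_ex)
  then show ?thesis using that by blast
qed

text \<open>No explicit decoder is required: a receiver may pick any message consistent with the
  received word and its side information, since \<open>sep\<close> makes all of them agree at the
  demanded position.\<close>

lemma ecicI:
  assumes E: "\<And>x. x \<in> carrier_vec (num_vertices H) \<Longrightarrow> E x \<in> carrier_vec N"
    and sep: "\<And>i x y \<epsilon> \<eta>. \<lbrakk>i < num_receivers H; x \<in> carrier_vec (num_vertices H);
      y \<in> carrier_vec (num_vertices H); \<epsilon> \<in> carrier_vec N; \<eta> \<in> carrier_vec N;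
      wt \<epsilon> \<le> \<delta>; wt \<eta> \<le> \<delta>; E x + \<epsilon> = E y + \<eta>;
      subvec x (side_info H i) = subvec y (side_info H i)\<rbrakk> \<Longrightarrow> x $ demand H i = y $ demand H i"
  shows "ecic \<delta> H N E"
  unfolding ecic_def
proof (intro conjI ballI allI impI)
  fix i assume i: "i < num_receivers H"
  \<comment> \<open>\<open>?P w s x\<close> says that \<open>x\<close> could have produced the
    received word \<open>w\<close> and the side information \<open>s\<close>.\<close>
  let ?P = "\<lambda>w s x. x \<in> carrier_vec (num_vertices H) \<and> s = subvec x (side_info H i) \<and>
    (\<exists>\<epsilon> \<in> carrier_vec N. wt \<epsilon> \<le> \<delta> \<and> w = E x + \<epsilon>)"
  have "(SOME x. ?P (E x' + \<epsilon>) (subvec x' (side_info H i)) x) $ demand H i = x' $ demand H i"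
    if x': "x' \<in> carrier_vec (num_vertices H)" "\<epsilon> \<in> carrier_vec N" "wt \<epsilon> \<le> \<delta>" for x' \<epsilon>
  proof (rule someI2[of _ x'])
    show "?P (E x' + \<epsilon>) (subvec x' (side_info H i)) x'" using x' by blast
    show "x $ demand H i = x' $ demand H i" if "?P (E x' + \<epsilon>) (subvec x' (side_info H i)) x" for x
      using that x' sep[OF i, of x x'] by metis
  qed
  then show "\<exists>D. \<forall>x \<in> carrier_vec (num_vertices H). \<forall>\<epsilon> \<in> carrier_vec N. wt \<epsilon> \<le> \<delta> \<longrightarrow>
          D (E x + \<epsilon>) (subvec x (side_info H i)) = x $ demand H i"
    by (intro exI[of _ "\<lambda>w s. (SOME x. ?P w s x) $ demand H i"]) blast
qed (rule E)

text \<open>Otherwise the difference of the codewords, being a difference of two errors, would have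
  weight at most \<open>2 * \<delta>\<close>, below the minimum distance.\<close>

lemma code_separates_errors:
  fixes C :: "'a::field vec set"
  assumes C: "C \<subseteq> carrier_vec N" "min_dist C = 2 * \<delta> + 1"
    and cc: "c \<in> C" "c' \<in> C" and e: "\<epsilon> \<in> carrier_vec N" "\<eta> \<in> carrier_vec N"
    and w: "wt \<epsilon> \<le> \<delta>" "wt \<eta> \<le> \<delta>" and eq: "c + \<epsilon> = c' + \<eta>"
  shows "c = c'"
proof (rule ccontr)
  assume "c \<noteq> c'"
  from min_dist_le[OF cc this] C(2) have le: "2 * \<delta> + 1 \<le> wt (c - c')" by simp
  have car: "c \<in> carrier_vec N" "c' \<in> carrier_vec N" using C cc by auto
  have "c - c' = \<eta> - \<epsilon>"
  proof (rule eq_vecI)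
    fix i assume i: "i < dim_vec (\<eta> - \<epsilon>)"
    then have "c $ i + \<epsilon> $ i = c' $ i + \<eta> $ i"
      using arg_cong[OF eq, of "\<lambda>v. v $ i"] car e by simp
    then show "(c - c') $ i = (\<eta> - \<epsilon>) $ i"
      using i car e by (simp add: algebra_simps)
  qed (use car e in auto)
  then show False using le wt_minus_le[OF e(2,1)] w by simp
qed

theorem propositionV2:
  fixes m n \<delta> :: nat and X :: "nat \<Rightarrow> nat set" and f :: "nat \<Rightarrow> nat"
  assumes "icsi_instance m n X f"
  defines "H \<equiv> side_info_hypergraph m n X f"
  shows "opt_ecic_length TYPE('q::{field,finite}) H \<delta>
         \<le> shortest_code_length TYPE('q) (min_rank TYPE('q) H) (2 * \<delta> + 1)"
proof -
  have m: "0 < m" and f: "\<And>i. i < m \<Longrightarrow> f i < n" and fX: "\<And>i. i < m \<Longrightarrow> f i \<notin> X i"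
    using assms(1) by (auto simp: icsi_instance_def)
  have H: "num_vertices H = n" "num_receivers H = m"
    "\<And>i. i < m \<Longrightarrow> demand H i = f i" "\<And>i. i < m \<Longrightarrow> side_info H i = X i"
    by (auto simp: H_def side_info_hypergraph_def)
  let ?k = "min_rank TYPE('q) H"
  let ?N = "shortest_code_length TYPE('q) ?k (2 * \<delta> + 1)"
  interpret V: vec_space "TYPE('q)" n .
  interpret W: vec_space "TYPE('q)" ?N .
  obtain v :: "nat \<Rightarrow> 'q vec" where v: "\<And>i. i < m \<Longrightarrow> v i \<in> carrier_vec n"
    "\<And>i. i < m \<Longrightarrow> supp (v i) \<subseteq> X i"
    and k: "?k = V.family_rank {..<m} (\<lambda>i. v i + unit_vec n (demand H i))"
    using min_rank_attained[of H, where 'a='q] by (auto simp: H)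
  define w where "w i = v i + unit_vec n (f i)" for i
  have w: "w i \<in> carrier_vec n" if "i < m" for i using v(1)[OF that] by (simp add: w_def)
  have img: "(\<lambda>i. v i + unit_vec n (demand H i)) ` {..<m} = w ` {..<m}"
    by (intro image_cong) (auto simp: w_def H)
  have wV: "w ` {..<m} \<subseteq> carrier_vec n" using w by auto
  have dim: "vectorspace.dim class_ring (V.span_vs (w ` {..<m})) = ?k"
    unfolding k V.family_rank_def img ..
  have "subspace class_ring (V.span (w ` {..<m})) V.V"
    using V.span_is_subspace wV by simp
  then obtain B where B: "B \<in> carrier_mat n ?k"
    "V.span (w ` {..<m}) = (*\<^sub>v) B ` carrier_vec ?k"
    using dim by (rule V.subspace_basis_mat)
  \<comment> \<open>Each \<open>w i\<close> is one of the spanning vectors, hence in the range of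
    \<open>B\<close>.\<close>
  have wB: "\<exists>y \<in> carrier_vec ?k. w i = B *\<^sub>v y" if "i < m" for i
    using V.in_own_span[of "w ` {..<m}"] wV that B(2) by auto
  have kpos: "0 < ?k"
  proof (rule ccontr)
    assume "\<not> 0 < ?k"
    \<comment> \<open>With no columns in \<open>B\<close>, every entry of
      \<open>B *\<^sub>v y\<close> is an empty sum.\<close>
    then have "w 0 = 0\<^sub>v n" using wB[OF m] B(1) by (auto intro!: eq_vecI simp: scalar_prod_def)
    moreover have "v 0 $ f 0 = 0" using v[OF m] fX[OF m] f[OF m] by (auto simp: supp_def)
    then have "w 0 $ f 0 = 1" using v(1)[OF m] f[OF m] by (simp add: w_def)
    ultimately show False using f[OF m] by simp
  qed
  obtain C :: "'q vec set" where C: "W.linear_code C ?k (2 * \<delta> + 1)"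
    using shortest_code[OF kpos, of "2 * \<delta> + 1"] by auto
  then have dimC: "vectorspace.dim class_ring (W.vs C) = ?k" and CV: "subspace class_ring C W.V"
    and dC: "min_dist C = 2 * \<delta> + 1"
    unfolding W.linear_code_def by blast+
  from CV dimC obtain G where G: "G \<in> carrier_mat ?N ?k"
    "C = (*\<^sub>v) G ` carrier_vec ?k" "inj_on ((*\<^sub>v) G) (carrier_vec ?k)"
    by (rule W.subspace_basis_mat)
  have Csub: "C \<subseteq> carrier_vec ?N" using G by auto
  define E where "E x = G *\<^sub>v (B\<^sup>T *\<^sub>v x)" for x
  have BT: "B\<^sup>T *\<^sub>v x \<in> carrier_vec ?k" if "x \<in> carrier_vec n" for x
    using B that by auto
  have EC: "E x \<in> C" if "x \<in> carrier_vec n" for x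
    using BT[OF that] unfolding E_def G(2) by blast
  have "linear_encoder n ?N E"
    unfolding linear_encoder_def
  proof (intro bexI ballI)
    \<comment> \<open>The encoding matrix is \<open>B * G\<^sup>T\<close>, because its transpose is
      \<open>G * B\<^sup>T\<close>.\<close>
    show "B * G\<^sup>T \<in> carrier_mat n ?N" using B G by auto
    show "E x = (B * G\<^sup>T)\<^sup>T *\<^sub>v x" if "x \<in> carrier_vec n" for x
      using B(1) G(1) that by (simp add: E_def transpose_mult[of _ n ?k _ ?N])
  qed
  moreover have "ecic \<delta> H ?N E"
  proof (rule ecicI; unfold H(1,2))
    show "E x \<in> carrier_vec ?N" if "x \<in> carrier_vec n" for x using EC[OF that] Csub by blast
    fix i and x y \<epsilon> \<eta> :: "'q vec"
    assume i: "i < m" and x: "x \<in> carrier_vec n" and y: "y \<in> carrier_vec n"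
      and e: "\<epsilon> \<in> carrier_vec ?N" "\<eta> \<in> carrier_vec ?N" "wt \<epsilon> \<le> \<delta>" "wt \<eta> \<le> \<delta>"
      and eq: "E x + \<epsilon> = E y + \<eta>"
      and sub: "subvec x (side_info H i) = subvec y (side_info H i)"
    have "E x = E y"
      using code_separates_errors[OF Csub dC EC[OF x] EC[OF y] e eq] .
    then have Bxy: "B\<^sup>T *\<^sub>v x = B\<^sup>T *\<^sub>v y"
      using G(3) BT x y unfolding E_def by (auto dest: inj_onD)
    obtain u where u: "u \<in> carrier_vec ?k" "w i = B *\<^sub>v u" using wB[OF i] by blast
    \<comment> \<open>Since \<open>w i = B *\<^sub>v u\<close>, its inner product with
      \<open>x\<close> equals that of \<open>B\<^sup>T *\<^sub>v x\<close> with \<open>u\<close>,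
      which \<open>Bxy\<close> determines.\<close>
    have "x \<bullet> w i = y \<bullet> w i"
      using transpose_vec_mult_scalar[OF B(1) u(1)] x y u(2) Bxy by metis
    moreover have "x \<bullet> v i = y \<bullet> v i"
    proof (rule scalar_prod_eq_on_supp[OF v(1)[OF i] x y])
      fix j assume "j \<in> supp (v i)"
      then have "j \<in> X i" "j < n" using v[OF i] by (auto simp: supp_def)
      then show "x $ j = y $ j" using subvec_eqD[OF sub x y, of j] H(4)[OF i] by simp
    qed
    \<comment> \<open>The inner product with \<open>w i\<close> is the one with \<open>v i\<close>
      plus the entry at \<open>f i\<close>; the former cancels.\<close>
    ultimately have "x $ f i = y $ f i"
      using v(1)[OF i] x y f[OF i] by (simp add: w_def scalar_prod_add_distrib[of _ n])
    then show "x $ demand H i = y $ demand H i" using H(3)[OF i] by simp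
  qed
  ultimately show ?thesis
    unfolding opt_ecic_length_def H(1) by (intro Least_le) blast
qed

end
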